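(* Consider the bilevel problem $\min_{y\in\mathcal Q_1}\max_{x\in\mathcal Q_2(y)}f(y,x)$. Let $c_1,c_2\ge1$ be constants and suppose that $\tilde f:\mathcal Q_1\to\mathbb R$ is a surrogate function satisfying $$\frac1{c_2}\tilde f(y)\ \le\ \max_{x\in\mathcal Q_2(y)}f(y,x)\ \le\ c_1\tilde f(y)\qquad\text{for all }y\in\mathcal Q_1.$$ If the surrogate problem $\min_{y\in\mathcal Q_1}\tilde f(y)$ admits a polynomial-time $c_3$-approximation algorithm ($c_3\ge1$), then the bilevel problem $\min_{y\in\mathcal Q_1}\max_{x\in\mathcal Q_2(y)}f(y,x)$ admits a polynomial-time $c_1c_2c_3$-approximation algorithm.
   Context: $\mathcal Q_1$ is the leader's feasible region, $\mathcal Q_2(y)$ is the follower's feasible region given the leader decision $y\in\mathcal Q_1$, and $f(y,x)$ is a real-valued objective; all minima and maxima written are assumed to be attained. The statement is about a class of problem instances (each specifying $\mathcal Q_1,\mathcal Q_2,f$ and the associated $\tilde f$), with the constants $c_1,c_2,c_3$ the same for all instances. A solution $\hat y\in\mathcal Q_1$ is an $\alpha$-approximate solution ($\alpha\ge1$) of the bilevel problem if $\max_{x\in\mathcal Q_2(\hat y)}f(\hat y,x)\le\alpha\cdot\min_{y\in\mathcal Q_1}\max_{x\in\mathcal Q_2(y)}f(y,x)$, and of the surrogate problem if $\tilde f(\hat y)\le\alpha\cdot\min_{y\in\mathcal Q_1}\tilde f(y)$. A polynomial-time $\alpha$-approximation algorithm is an algorithm that returns an $\alpha$-approximate solution in polynomial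 time for every instance. *)

theory Defs
  imports Complex_Main "HOL-Computational_Algebra.Polynomial"
begin

text \<open>The surrogate function and the objective matter only on the feasible regions.\<close>

record ('y, 'x) bilevel_instance =
  leader :: "'y set"
  follower :: "'y \<Rightarrow> 'x set"
  objective :: "'y \<Rightarrow> 'x \<Rightarrow> real"
  surrogate :: "'y \<Rightarrow> real"

definition has_max :: "real set \<Rightarrow> bool" where
  "has_max A \<longleftrightarrow> (\<exists>m\<in>A. \<forall>z\<in>A. z \<le> m)"

definition has_min :: "real set \<Rightarrow> bool" where
  "has_min A \<longleftrightarrow> (\<exists>m\<in>A. \<forall>z\<in>A. m \<le> z)"

definition max_over :: "'a set \<Rightarrow> ('a \<Rightarrow> real) \<Rightarrow> real" where
  "max_over A g = (GREATEST m. m \<in> g ` A)"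

definition min_over :: "'a set \<Rightarrow> ('a \<Rightarrow> real) \<Rightarrow> real" where
  "min_over A g = (LEAST m. m \<in> g ` A)"

definition follower_max :: "('y, 'x) bilevel_instance \<Rightarrow> 'y \<Rightarrow> real" where
  "follower_max P y = max_over (follower P y) (objective P y)"

definition optima_attained :: "('y, 'x) bilevel_instance \<Rightarrow> bool" where
  "optima_attained P \<longleftrightarrow>
     (\<forall>y\<in>leader P. has_max (objective P y ` follower P y)) \<and>
     has_min (follower_max P ` leader P) \<and>
     has_min (surrogate P ` leader P)"

definition bilevel_approx :: "real \<Rightarrow> ('y, 'x) bilevel_instance \<Rightarrow> 'y \<Rightarrow> bool" where
  "bilevel_approx \<alpha> P y \<longleftrightarrow>
     y \<in> leader P \<and> follower_max P y \<le> \<alpha> * min_over (leader P) (follower_max P)"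

definition surrogate_approx :: "real \<Rightarrow> ('y, 'x) bilevel_instance \<Rightarrow> 'y \<Rightarrow> bool" where
  "surrogate_approx \<alpha> P y \<longleftrightarrow>
     y \<in> leader P \<and> surrogate P y \<le> \<alpha> * min_over (leader P) (surrogate P)"

text \<open>
  States are the numbers below \<open>states M\<close>, with start state \<open>0\<close>; tape symbols are the numbers
  below \<open>symbols M\<close>, with \<open>0\<close> the blank and \<open>1\<close>, \<open>2\<close> the two input bits. The machine halts
  when no transition is defined. A configuration is a state, a head position and a two-way
  infinite tape.
\<close>

datatype move = Move_Left | Stay | Move_Right

record tm =
  states :: nat
  symbols :: nat
  trans :: "nat \<Rightarrow> nat \<Rightarrow> (nat \<times> nat \<times> move) option"

definition wf_tm :: "tm \<Rightarrow> bool" where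
  "wf_tm M \<longleftrightarrow> 0 < states M \<and> 3 \<le> symbols M \<and>
     (\<forall>q s q' s' d. q < states M \<longrightarrow> s < symbols M \<longrightarrow> trans M q s = Some (q', s', d) \<longrightarrow>
        q' < states M \<and> s' < symbols M)"

type_synonym config = "nat \<times> int \<times> (int \<Rightarrow> nat)"

fun shift :: "move \<Rightarrow> int \<Rightarrow> int" where
  "shift Move_Left h = h - 1"
| "shift Stay h = h"
| "shift Move_Right h = h + 1"

fun step :: "tm \<Rightarrow> config \<Rightarrow> config" where
  "step M (q, h, t) =
     (case trans M q (t h) of
        None \<Rightarrow> (q, h, t)
      | Some (q', s', d) \<Rightarrow> (q', shift d h, t(h := s')))"

fun halted :: "tm \<Rightarrow> config \<Rightarrow> bool" where
  "halted M (q, h, t) \<longleftrightarrow> trans M q (t h) = None"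

definition word_tape :: "bool list \<Rightarrow> int \<Rightarrow> nat" where
  "word_tape w i =
     (if 0 \<le> i \<and> i < int (length w) then (if w ! nat i then 2 else 1) else 0)"

definition initial :: "bool list \<Rightarrow> config" where
  "initial w = (0, 0, word_tape w)"

text \<open>
  On input \<open>w\<close> the machine halts after at most \<open>n\<close> steps and leaves exactly the word \<open>v\<close> on the
  tape, starting at cell \<open>0\<close>; the final head position is irrelevant.
\<close>

definition outputs_within :: "tm \<Rightarrow> bool list \<Rightarrow> nat \<Rightarrow> bool list \<Rightarrow> bool" where
  "outputs_within M w n v \<longleftrightarrow>
     (\<exists>q h. (step M ^^ n) (initial w) = (q, h, word_tape v) \<and> halted M (q, h, word_tape v))"

lemma word_tape_inject: "word_tape v = word_tape w \<longleftrightarrow> v = w"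
proof
  assume eq: "word_tape v = word_tape w"
  have nth: "i < length v \<longleftrightarrow> i < length w" "i < length v \<Longrightarrow> v ! i = w ! i" for i
    using fun_cong[OF eq, of "int i"] by (auto simp: word_tape_def split: if_splits)
  then have "length v = length w"
    by (meson linorder_neqE_nat less_irrefl)
  then show "v = w"
    using nth(2) by (rule nth_equalityI)
qed simp

lemma halted_steps: "halted M c \<Longrightarrow> (step M ^^ n) c = c"
  by (induction n) (cases c, auto)+

lemma outputs_within_unique:
  assumes "outputs_within M w m u" and "outputs_within M w n v"
  shows "u = v"
proof -
  have *: "u = v" if "m \<le> n" "outputs_within M w m u" "outputs_within M w n v" for m n u v
  proof -
    have "(step M ^^ n) (initial w) = (step M ^^ (n - m)) ((step M ^^ m) (initial w))"
      using that(1) by (metis comp_apply funpow_add le_add_diff_inverse2)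
    with that(2,3) show ?thesis
      unfolding outputs_within_def
      by (metis Pair_inject halted_steps word_tape_inject)
  qed
  show ?thesis
    using *[of m n u v] *[of n m v u] assms by (metis nle_le)
qed

text \<open>
  A class of instances is given by a partial map \<open>inst\<close> sending each bit string that describes an
  instance to that instance (one instance may have several descriptions); likewise \<open>sol\<close> maps
  output strings to the leader decisions they denote. A description specifies the whole instance,
  surrogate included, so the bilevel and the surrogate problem share their inputs. The running
  time is measured in the length of the description.
\<close>

definition poly_time_solver ::
  "(bool list \<rightharpoonup> ('y, 'x) bilevel_instance) \<Rightarrow> (bool list \<rightharpoonup> 'y) \<Rightarrow>
   (('y, 'x) bilevel_instance \<Rightarrow> 'y \<Rightarrow> bool) \<Rightarrow> tm \<Rightarrow> bool" where
  "poly_time_solver inst sol good M \<longleftrightarrow> wf_tm M \<and>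
     (\<exists>p :: nat poly. \<forall>w P. inst w = Some P \<longrightarrow>
        (\<exists>v y. outputs_within M w (poly p (length w)) v \<and> sol v = Some y \<and> good P y))"

definition bilevel_admits_poly_approx ::
  "(bool list \<rightharpoonup> ('y, 'x) bilevel_instance) \<Rightarrow> (bool list \<rightharpoonup> 'y) \<Rightarrow> real \<Rightarrow> bool" where
  "bilevel_admits_poly_approx inst sol \<alpha> \<longleftrightarrow>
     (\<exists>M. poly_time_solver inst sol (bilevel_approx \<alpha>) M)"

definition surrogate_admits_poly_approx ::
  "(bool list \<rightharpoonup> ('y, 'x) bilevel_instance) \<Rightarrow> (bool list \<rightharpoonup> 'y) \<Rightarrow> real \<Rightarrow> bool" where
  "surrogate_admits_poly_approx inst sol \<alpha> \<longleftrightarrow>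
     (\<exists>M. poly_time_solver inst sol (surrogate_approx \<alpha>) M)"

end

theory Submission
  imports Defs
begin

text \<open>
  The algorithm for the surrogate problem is itself the algorithm for the bilevel problem: both
  problems share their inputs and their outputs, so only the quality of the returned decision has
  to be transferred. Write \<open>F\<close> for the follower's optimal value as a function of the leader's
  decision, \<open>s\<close> for the surrogate, \<open>y\<close> for the returned decision and \<open>z\<close> for a minimizer of
  \<open>F\<close>. Then
  \<open>F y \<le> c\<^sub>1 * s y \<le> c\<^sub>1 * c\<^sub>3 * min s \<le> c\<^sub>1 * c\<^sub>3 * s z \<le> c\<^sub>1 * c\<^sub>2 * c\<^sub>3 * F z\<close>:
  the upper estimate is paid for at the returned decision and the lower one at the optimal
  decision. Only the constants are ever multiplied into an inequality, so the values of \<open>F\<close> and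
  \<open>s\<close> may have any sign.
\<close>

lemma min_over_eqI:
  assumes "z \<in> A" and "\<And>y. y \<in> A \<Longrightarrow> g z \<le> g y"
  shows "min_over A g = g z"
  unfolding min_over_def using assms by (intro Least_equality) auto

lemma has_min_obtain_minimizer:
  assumes "has_min (g ` A)"
  obtains z where "z \<in> A" and "\<And>y. y \<in> A \<Longrightarrow> g z \<le> g y" and "min_over A g = g z"
proof -
  from assms obtain z where "z \<in> A" "\<And>y. y \<in> A \<Longrightarrow> g z \<le> g y"
    by (auto simp: has_min_def)
  with that min_over_eqI[of z A g] show thesis by blast
qed

text \<open>
  \<open>min_over\<close> is defined by a description operator and is a lower bound only because the minimum
  is attained.
\<close>

lemma min_over_le:
  assumes "has_min (g ` A)" and "y \<in> A"
  shows "min_over A g \<le> g y"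
  using assms by (metis has_min_obtain_minimizer)

text \<open>
  The transfer for a single instance, by the chain of estimates above. The sandwich has \<open>s\<close>
  bounded by \<open>b * F\<close> rather than \<open>s / b\<close> bounded by \<open>F\<close>, so that no division occurs.
\<close>

lemma approx_minimizer_transfer:
  fixes F s :: "'a \<Rightarrow> real"
  assumes "0 \<le> a" and "0 \<le> c"
    and attained: "has_min (F ` A)" "has_min (s ` A)"
    and lower: "\<And>z. z \<in> A \<Longrightarrow> s z \<le> b * F z"
    and upper: "\<And>z. z \<in> A \<Longrightarrow> F z \<le> a * s z"
    and y: "y \<in> A" "s y \<le> c * min_over A s"
  shows "F y \<le> a * b * c * min_over A F"
proof -
  obtain z where z: "z \<in> A" "min_over A F = F z"
    using attained(1) by (metis has_min_obtain_minimizer)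
  have "min_over A s \<le> b * F z"
    using min_over_le[OF attained(2) z(1)] lower[OF z(1)] by linarith
  then have "s y \<le> c * (b * F z)"
    using y(2) mult_left_mono[OF _ \<open>0 \<le> c\<close>] by (meson order_trans)
  then have "F y \<le> a * (c * (b * F z))"
    using upper[OF y(1)] mult_left_mono[OF _ \<open>0 \<le> a\<close>] by (meson order_trans)
  then show ?thesis
    by (simp add: z(2) mult_ac)
qed

lemma poly_time_solver_mono:
  assumes "poly_time_solver inst sol good M"
    and "\<And>P y. P \<in> ran inst \<Longrightarrow> good P y \<Longrightarrow> good' P y"
  shows "poly_time_solver inst sol good' M"
  using assms unfolding poly_time_solver_def by (meson ranI)

theorem proposition1:
  fixes inst :: "bool list \<rightharpoonup> ('y, 'x) bilevel_instance"
    and sol :: "bool list \<rightharpoonup> 'y"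
    and c1 c2 c3 :: real
  assumes "c1 \<ge> 1" and "c2 \<ge> 1" and "c3 \<ge> 1"
    and "\<And>P. P \<in> ran inst \<Longrightarrow> optima_attained P"
    and "\<And>P y. P \<in> ran inst \<Longrightarrow> y \<in> leader P \<Longrightarrow>
           1 / c2 * surrogate P y \<le> max_over (follower P y) (objective P y) \<and>
           max_over (follower P y) (objective P y) \<le> c1 * surrogate P y"
    and "surrogate_admits_poly_approx inst sol c3"
  shows "bilevel_admits_poly_approx inst sol (c1 * c2 * c3)"
proof -
  have transfer: "bilevel_approx (c1 * c2 * c3) P y"
    if P: "P \<in> ran inst" and y: "surrogate_approx c3 P y" for P y
  proof -
    have "follower_max P y \<le> c1 * c2 * c3 * min_over (leader P) (follower_max P)"
    proof (rule approx_minimizer_transfer[where s = "surrogate P"])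
      show "0 \<le> c1" "0 \<le> c3"
        using assms(1,3) by simp_all
      show "has_min (follower_max P ` leader P)" "has_min (surrogate P ` leader P)"
        using assms(4)[OF P] by (simp_all add: optima_attained_def)
      show "surrogate P z \<le> c2 * follower_max P z" if "z \<in> leader P" for z
        using assms(5)[OF P that] assms(2) by (simp add: follower_max_def field_simps)
      show "follower_max P z \<le> c1 * surrogate P z" if "z \<in> leader P" for z
        using assms(5)[OF P that] by (simp add: follower_max_def)
      show "y \<in> leader P" "surrogate P y \<le> c3 * min_over (leader P) (surrogate P)"
        using y by (simp_all add: surrogate_approx_def)
    qed
    with y show ?thesis
      by (simp add: bilevel_approx_def surrogate_approx_def)
  qed
  obtain M where "poly_time_solver inst sol (surrogate_approx c3) M"
    using assms(6) by (auto simp: surrogate_admits_poly_approx_def)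
  then have "poly_time_solver inst sol (bilevel_approx (c1 * c2 * c3)) M"
    using transfer by (rule poly_time_solver_mono)
  then show ?thesis
    by (auto simp: bilevel_admits_poly_approx_def)
qed

end
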